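(* Let $F:\mathbb{R}^n\to\mathbb{R}$ be a $\mu$-strongly convex function ($\mu>0$) with minimizer $\mathbf{x}^*$. Let $\tau\ge1$ be an integer, $\beta>0$, and let $\xi_1,\dots,\xi_\tau\in\mathbb{R}$ satisfy $\sum_{i=1}^\tau\xi_i=1$ and $\xi_i\ge0$ for all $i$. Given arbitrary initial points $\mathbf{x}^{(0)},\dots,\mathbf{x}^{(\tau-1)}\in\mathbb{R}^n$, define for $k\ge\tau-1$ $$\mathbf{x}^{(k+1)}=\mathbf{prox}_{\beta F}(\tilde{\mathbf{x}}^{(k)}),\qquad\tilde{\mathbf{x}}^{(k)}=\sum_{i=1}^{\tau}\xi_i\,\mathbf{x}^{(k-\tau+i)}.$$ Then $\mathbf{x}^{(k)}$ converges to $\mathbf{x}^*$ linearly: for all $k\ge0$, $$\|\mathbf{x}^{(k)}-\mathbf{x}^*\|\le\left(\frac{1}{1+\beta\mu}\right)^{\lfloor k/\tau\rfloor}\max_{j\in\{0,1,\dots,\tau-1\}}\|\mathbf{x}^{(j)}-\mathbf{x}^*\|.$$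
   Context: All norms are Euclidean norms. $\mathbf{prox}_{\beta F}(\mathbf{x})=\operatorname{argmin}_{\mathbf{z}}F(\mathbf{z})+\frac{1}{2\beta}\|\mathbf{x}-\mathbf{z}\|^2$. $F$ is $\mu$-strongly convex if $\mu>0$ and $F(\mathbf{y})\ge F(\mathbf{x})+\langle\zeta,\mathbf{y}-\mathbf{x}\rangle+\frac{\mu}{2}\|\mathbf{y}-\mathbf{x}\|^2$ for all $\mathbf{x},\mathbf{y}$ and all subgradients $\zeta\in\partial F(\mathbf{x})$ ($F$ is not assumed differentiable; equivalently $F-\frac{\mu}{2}\|\cdot\|^2$ is convex). *)

theory Defs
  imports "HOL-Analysis.Analysis"
begin

definition subdifferential :: "('a::real_inner \<Rightarrow> real) \<Rightarrow> 'a \<Rightarrow> 'a set" where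
  "subdifferential F x = {\<zeta>. \<forall>y. F y \<ge> F x + \<zeta> \<bullet> (y - x)}"

text \<open>
  Convexity is required explicitly: the subgradient inequality alone would hold vacuously
  at points where the subdifferential is empty. With it, the definition is equivalent
  (for finite-valued functions on Euclidean space and positive \<open>\<mu>\<close>) to convexity of
  \<open>\<lambda>x. F x - \<mu> / 2 * (norm x)\<^sup>2\<close>.
\<close>

definition strongly_convex :: "real \<Rightarrow> ('a::real_inner \<Rightarrow> real) \<Rightarrow> bool" where
  "strongly_convex \<mu> F \<longleftrightarrow>
     \<mu> > 0 \<and> convex_on UNIV F \<and>
     (\<forall>x y. \<forall>\<zeta>\<in>subdifferential F x.
        F y \<ge> F x + \<zeta> \<bullet> (y - x) + \<mu> / 2 * (norm (y - x))\<^sup>2)"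

text \<open>
  \<open>arg_min\<close> picks some minimizer, and an unspecified value if there is none; for convex
  real-valued \<open>F\<close> on Euclidean space and \<open>\<beta> > 0\<close> the minimizer exists and is unique.
\<close>

definition prox :: "real \<Rightarrow> ('a::real_inner \<Rightarrow> real) \<Rightarrow> 'a \<Rightarrow> 'a" where
  "prox \<beta> F x = arg_min (\<lambda>z. F z + 1 / (2 * \<beta>) * (norm (x - z))\<^sup>2) (\<lambda>_. True)"

end

theory Submission
  imports Defs
begin

text \<open>
  The proximal map contracts the distance to the minimizer by the factor
  \<open>\<rho> = 1 / (1 + \<beta> * \<mu>)\<close>. If \<open>p\<close> minimizes \<open>F + norm (x - \<cdot>)\<^sup>2 / (2 * \<beta>)\<close>, then
  \<open>(x - p) / \<beta>\<close> is a subgradient of \<open>F\<close> at \<open>p\<close>, while \<open>0\<close> is one at the minimizer. Adding the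
  strong convexity inequalities for these two subgradients gives
  \<open>(1 + \<beta> * \<mu>) * (norm (p - xstar))\<^sup>2 \<le> (x - xstar) \<bullet> (p - xstar)\<close>, and Cauchy-Schwarz
  yields the contraction (lemma \<open>prox_contraction\<close>).

  Each new error is thus at most \<open>\<rho>\<close> times a convex combination of the \<open>\<tau>\<close> preceding errors.
  By complete induction these are at most \<open>\<rho> ^ ((k - \<tau>) div \<tau>)\<close> times the initial maximum,
  the power being decreasing in the index, so the factor \<open>\<rho>\<close> gains one full exponent per
  \<open>\<tau>\<close> steps (lemma \<open>delayed_contraction_bound\<close>).
\<close>

text \<open>
  The minimizer defining \<open>prox\<close> exists as soon as \<open>F\<close> is convex and bounded below: outside a large
  ball around \<open>x\<close> the quadratic term alone pushes the objective above its value at \<open>x\<close>.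
\<close>

lemma is_arg_min_prox:
  fixes F :: "'a::euclidean_space \<Rightarrow> real"
  assumes "convex_on UNIV F" and lower: "\<And>z. m \<le> F z" and "\<beta> > 0"
  shows "is_arg_min (\<lambda>z. F z + 1 / (2 * \<beta>) * (norm (x - z))\<^sup>2) (\<lambda>_. True) (prox \<beta> F x)"
proof -
  define G where "G = (\<lambda>z. F z + 1 / (2 * \<beta>) * (norm (x - z))\<^sup>2)"
  define r where "r = sqrt (2 * \<beta> * (F x - m))"
  have r: "r \<ge> 0" "r\<^sup>2 = 2 * \<beta> * (F x - m)"
    using lower[of x] \<open>\<beta> > 0\<close> by (simp_all add: r_def)
  have "continuous_on UNIV F"
    using convex_on_continuous[of UNIV F] assms(1) by simp
  then have "continuous_on (cball x r) G"
    unfolding G_def by (intro continuous_intros) (auto intro: continuous_on_subset)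
  then have "\<exists>p\<in>cball x r. \<forall>z\<in>cball x r. G p \<le> G z"
    using r(1) by (intro continuous_attains_inf) auto
  then obtain p where p: "\<And>z. z \<in> cball x r \<Longrightarrow> G p \<le> G z"
    by blast
  have "G p \<le> G z" for z
  proof (cases "z \<in> cball x r")
    case True
    then show ?thesis by (rule p)
  next
    case False
    then have "r\<^sup>2 \<le> (norm (x - z))\<^sup>2"
      using r(1) by (intro power_mono) (auto simp: dist_norm)
    then have "F x - m \<le> 1 / (2 * \<beta>) * (norm (x - z))\<^sup>2"
      using r(2) \<open>\<beta> > 0\<close> by (simp add: field_simps)
    then have "G x \<le> G z"
      using lower[of z] by (simp add: G_def)
    with p[of x] r(1) show ?thesis by simp
  qed
  then have "is_arg_min G (\<lambda>_. True) p"
    by (simp add: is_arg_min_linorder)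
  then have "is_arg_min G (\<lambda>_. True) (arg_min G (\<lambda>_. True))"
    unfolding arg_min_def by (rule someI)
  then show ?thesis
    by (simp add: prox_def G_def)
qed

text \<open>First-order optimality condition for the proximal objective.\<close>

lemma prox_subgradient:
  fixes F :: "'a::real_inner \<Rightarrow> real"
  assumes conv: "convex_on UNIV F" and "\<beta> > 0"
    and min: "is_arg_min (\<lambda>z. F z + 1 / (2 * \<beta>) * (norm (x - z))\<^sup>2) (\<lambda>_. True) p"
  shows "(x - p) /\<^sub>R \<beta> \<in> subdifferential F p"
proof -
  have "F p + ((x - p) /\<^sub>R \<beta>) \<bullet> (y - p) \<le> F y" for y
  proof -
    define A where "A = ((x - p) /\<^sub>R \<beta>) \<bullet> (y - p)"
    define B where "B = (norm (y - p))\<^sup>2 / (2 * \<beta>)"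
    \<comment> \<open>Compare \<open>p\<close> with a point on the segment towards \<open>y\<close>, at parameter \<open>t\<close>.\<close>
    have step: "F p + A - F y \<le> t * B" if t: "0 < t" "t < 1" for t
    proof -
      define q where "q = (1 - t) *\<^sub>R p + t *\<^sub>R y"
      have min_q: "F p + 1 / (2 * \<beta>) * (norm (x - p))\<^sup>2 \<le> F q + 1 / (2 * \<beta>) * (norm (x - q))\<^sup>2"
        using min by (simp add: is_arg_min_linorder)
      have conv_q: "F q \<le> (1 - t) * F p + t * F y"
        unfolding q_def using convex_onD[OF conv, of t p y] t by simp
      have xq: "x - q = (x - p) - t *\<^sub>R (y - p)"
        by (simp add: q_def algebra_simps)
      have A: "(x - p) \<bullet> (y - p) = \<beta> * A"
        using \<open>\<beta> > 0\<close> by (simp only: A_def inner_scaleR_left) simp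
      have "(norm (x - q))\<^sup>2
          = (norm (x - p))\<^sup>2 - 2 * t * ((x - p) \<bullet> (y - p)) + t\<^sup>2 * (norm (y - p))\<^sup>2"
        unfolding xq power2_norm_eq_inner inner_diff_left[of "x - p"] inner_diff_right[of _ "x - p"]
        by (simp add: inner_commute[of "y - p" "x - p"] power2_eq_square)
      then have "1 / (2 * \<beta>) * (norm (x - q))\<^sup>2
          = 1 / (2 * \<beta>) * (norm (x - p))\<^sup>2 - t * A + t * (t * B)"
        unfolding A using \<open>\<beta> > 0\<close> by (simp add: B_def field_simps power2_eq_square)
      with min_q conv_q have "t * (F p + A - F y) \<le> t * (t * B)"
        by (simp add: algebra_simps)
      with t show ?thesis by simp
    qed
    have "((\<lambda>t. t * B) \<longlongrightarrow> 0 * B) (at_right 0)"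
      by (intro tendsto_intros)
    moreover have "eventually (\<lambda>t. F p + A - F y \<le> t * B) (at_right 0)"
      using step by (auto simp: eventually_at_right_field intro!: exI[of _ 1])
    ultimately have "F p + A - F y \<le> 0 * B"
      by (intro tendsto_lowerbound) auto
    then show ?thesis by (simp add: A_def)
  qed
  then show ?thesis by (simp add: subdifferential_def)
qed

lemma prox_contraction:
  fixes F :: "'a::euclidean_space \<Rightarrow> real"
  assumes sc: "strongly_convex \<mu> F" and "is_arg_min F (\<lambda>_. True) xstar" and "\<beta> > 0"
  shows "norm (prox \<beta> F x - xstar) \<le> 1 / (1 + \<beta> * \<mu>) * norm (x - xstar)"
proof -
  define p where "p = prox \<beta> F x"
  have "\<mu> > 0" and conv: "convex_on UNIV F"
    and grow: "\<And>u v \<zeta>. \<zeta> \<in> subdifferential F u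
      \<Longrightarrow> F u + \<zeta> \<bullet> (v - u) + \<mu> / 2 * (norm (v - u))\<^sup>2 \<le> F v"
    using sc by (auto simp: strongly_convex_def)
  have xs: "F xstar \<le> F z" for z
    using assms(2) by (simp add: is_arg_min_linorder)
  have "(x - p) /\<^sub>R \<beta> \<in> subdifferential F p"
    unfolding p_def using is_arg_min_prox[OF conv xs \<open>\<beta> > 0\<close>]
    by (rule prox_subgradient[OF conv \<open>\<beta> > 0\<close>])
  from grow[OF this, of xstar]
  have 1: "F p + ((x - p) \<bullet> (xstar - p)) / \<beta> + \<mu> / 2 * (norm (p - xstar))\<^sup>2 \<le> F xstar"
    by (simp only: inner_scaleR_left norm_minus_commute[of p xstar] divide_inverse_commute)
  have "0 \<in> subdifferential F xstar"
    using xs by (simp add: subdifferential_def)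
  from grow[OF this, of p] have 2: "F xstar + \<mu> / 2 * (norm (p - xstar))\<^sup>2 \<le> F p"
    by simp
  from 1 2 have "((x - p) \<bullet> (xstar - p)) / \<beta> + \<mu> * (norm (p - xstar))\<^sup>2 \<le> 0"
    by simp
  then have "(x - p) \<bullet> (xstar - p) + \<beta> * \<mu> * (norm (p - xstar))\<^sup>2 \<le> 0"
    using \<open>\<beta> > 0\<close> by (simp add: field_simps)
  moreover have "(x - p) \<bullet> (xstar - p)
      = (norm (p - xstar))\<^sup>2 - (x - xstar) \<bullet> (p - xstar)"
    by (simp add: power2_norm_eq_inner inner_diff_left inner_diff_right inner_commute)
  ultimately have "(1 + \<beta> * \<mu>) * (norm (p - xstar))\<^sup>2 \<le> (x - xstar) \<bullet> (p - xstar)"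
    by (simp add: algebra_simps)
  also have "\<dots> \<le> norm (x - xstar) * norm (p - xstar)"
    by (rule norm_cauchy_schwarz)
  finally have "(1 + \<beta> * \<mu>) * norm (p - xstar) \<le> norm (x - xstar)"
    by (cases "p = xstar") (auto simp: power2_eq_square mult.assoc[symmetric])
  moreover have "1 + \<beta> * \<mu> > 0"
    using \<open>\<beta> > 0\<close> \<open>\<mu> > 0\<close> by (simp add: add_pos_pos)
  ultimately show ?thesis
    by (simp add: p_def field_simps)
qed

lemma delayed_contraction_bound:
  fixes e :: "nat \<Rightarrow> real"
  assumes "\<tau> \<ge> 1" and "0 \<le> \<rho>" "\<rho> \<le> 1" and "0 \<le> M"
    and sum1: "(\<Sum>i=1..\<tau>. \<xi> i) = 1" and nonneg: "\<And>i. i \<in> {1..\<tau>} \<Longrightarrow> \<xi> i \<ge> 0"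
    and init: "\<And>j. j < \<tau> \<Longrightarrow> e j \<le> M"
    and step: "\<And>k. k \<ge> \<tau> - 1 \<Longrightarrow> e (k + 1) \<le> \<rho> * (\<Sum>i=1..\<tau>. \<xi> i * e (k + i - \<tau>))"
  shows "e k \<le> \<rho> ^ (k div \<tau>) * M"
proof (induction k rule: less_induct)
  case (less k)
  show ?case
  proof (cases "k < \<tau>")
    case True
    then show ?thesis using init by simp
  next
    case False
    define l where "l = k - 1"
    have l: "k = l + 1" "\<tau> - 1 \<le> l"
      using False \<open>\<tau> \<ge> 1\<close> by (auto simp: l_def)
    define C where "C = \<rho> ^ ((k - \<tau>) div \<tau>) * M"
    have old: "e (l + i - \<tau>) \<le> C" if i: "i \<in> {1..\<tau>}" for i
    proof -
      have "l + i - \<tau> < k" and "k - \<tau> \<le> l + i - \<tau>"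
        using i l by auto
      then have "e (l + i - \<tau>) \<le> \<rho> ^ ((l + i - \<tau>) div \<tau>) * M"
        and "\<rho> ^ ((l + i - \<tau>) div \<tau>) \<le> \<rho> ^ ((k - \<tau>) div \<tau>)"
        using less assms(2,3) by (auto intro!: power_decreasing div_le_mono)
      then show ?thesis
        unfolding C_def using \<open>0 \<le> M\<close> by (meson mult_right_mono order_trans)
    qed
    have "(\<Sum>i=1..\<tau>. \<xi> i * e (l + i - \<tau>)) \<le> (\<Sum>i=1..\<tau>. \<xi> i * C)"
      by (intro sum_mono mult_left_mono old nonneg)
    also have "\<dots> = C"
      using sum1 by (simp flip: sum_distrib_right)
    finally have "e k \<le> \<rho> * C"
      using step[OF l(2)] l(1) mult_left_mono[OF _ \<open>0 \<le> \<rho>\<close>] by (metis order_trans)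
    moreover have "k div \<tau> = Suc ((k - \<tau>) div \<tau>)"
      using False \<open>\<tau> \<ge> 1\<close> by (intro le_div_geq) auto
    ultimately show ?thesis by (simp add: C_def mult.assoc)
  qed
qed

theorem theorem5p3:
  fixes F :: "real ^ 'n \<Rightarrow> real"
    and \<mu> \<beta> :: real
    and xstar :: "real ^ 'n"
    and \<tau> :: nat
    and \<xi> :: "nat \<Rightarrow> real"
    and x :: "nat \<Rightarrow> real ^ 'n"
  assumes "strongly_convex \<mu> F"
    and "is_arg_min F (\<lambda>_. True) xstar"
    and "\<tau> \<ge> 1"
    and "\<beta> > 0"
    and "(\<Sum>i=1..\<tau>. \<xi> i) = 1"
    and "\<And>i. i \<in> {1..\<tau>} \<Longrightarrow> \<xi> i \<ge> 0"
    and "\<And>k. k \<ge> \<tau> - 1 \<Longrightarrow> x (k + 1) = prox \<beta> F (\<Sum>i=1..\<tau>. \<xi> i *\<^sub>R x (k + i - \<tau>))"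
  shows "x \<longlonglongrightarrow> xstar \<and>
    (\<forall>k. norm (x k - xstar)
      \<le> (1 / (1 + \<beta> * \<mu>)) ^ (k div \<tau>) * (MAX j\<in>{0..\<tau> - 1}. norm (x j - xstar)))"
proof -
  define \<rho> where "\<rho> = 1 / (1 + \<beta> * \<mu>)"
  define M where "M = (MAX j\<in>{0..\<tau> - 1}. norm (x j - xstar))"
  have "\<mu> > 0"
    using assms(1) by (simp add: strongly_convex_def)
  then have "\<beta> * \<mu> > 0"
    using \<open>\<beta> > 0\<close> by simp
  then have \<rho>: "0 < \<rho>" "\<rho> < 1"
    by (simp_all add: \<rho>_def)
  have init: "norm (x j - xstar) \<le> M" if "j < \<tau>" for j
    unfolding M_def using that by (intro Max_ge) auto
  have "0 \<le> M"
    using init[of 0] \<open>\<tau> \<ge> 1\<close> norm_ge_zero[of "x 0 - xstar"] by linarith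
  have step: "norm (x (k + 1) - xstar)
      \<le> \<rho> * (\<Sum>i=1..\<tau>. \<xi> i * norm (x (k + i - \<tau>) - xstar))" if k: "k \<ge> \<tau> - 1" for k
  proof -
    define w where "w = (\<Sum>i=1..\<tau>. \<xi> i *\<^sub>R x (k + i - \<tau>))"
    \<comment> \<open>Since the weights sum to one, the error of the average is the average of the errors.\<close>
    have "w - xstar = w - (\<Sum>i=1..\<tau>. \<xi> i) *\<^sub>R xstar"
      using assms(5) by simp
    also have "\<dots> = (\<Sum>i=1..\<tau>. \<xi> i *\<^sub>R (x (k + i - \<tau>) - xstar))"
      by (simp add: w_def scaleR_sum_left sum_subtractf scaleR_diff_right)
    finally have "norm (w - xstar) \<le> (\<Sum>i=1..\<tau>. norm (\<xi> i *\<^sub>R (x (k + i - \<tau>) - xstar)))"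
      by (simp only: norm_sum)
    also have "\<dots> = (\<Sum>i=1..\<tau>. \<xi> i * norm (x (k + i - \<tau>) - xstar))"
      using assms(6) by (intro sum.cong) auto
    finally have "\<rho> * norm (w - xstar) \<le> \<rho> * (\<Sum>i=1..\<tau>. \<xi> i * norm (x (k + i - \<tau>) - xstar))"
      using \<rho> by simp
    moreover have "norm (x (k + 1) - xstar) \<le> \<rho> * norm (w - xstar)"
      using prox_contraction[OF assms(1,2,4)] assms(7)[OF k] by (simp add: \<rho>_def w_def)
    ultimately show ?thesis by linarith
  qed
  have bound: "norm (x k - xstar) \<le> \<rho> ^ (k div \<tau>) * M" for k
    using delayed_contraction_bound[where e = "\<lambda>k. norm (x k - xstar)" and \<xi> = \<xi>,
        OF \<open>\<tau> \<ge> 1\<close> less_imp_le[OF \<rho>(1)] less_imp_le[OF \<rho>(2)] \<open>0 \<le> M\<close> assms(5,6) init step] .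
  have "filterlim (\<lambda>k. k div \<tau>) at_top sequentially"
    unfolding filterlim_at_top
  proof
    fix c
    have "c \<le> k div \<tau>" if "c * \<tau> \<le> k" for k
      using that \<open>\<tau> \<ge> 1\<close> by (simp add: less_eq_div_iff_mult_less_eq)
    then show "eventually (\<lambda>k. c \<le> k div \<tau>) sequentially"
      by (auto simp: eventually_sequentially)
  qed
  moreover have "(\<lambda>n. \<rho> ^ n) \<longlonglongrightarrow> 0"
    using \<rho> by (intro LIMSEQ_realpow_zero) auto
  ultimately have "(\<lambda>k. \<rho> ^ (k div \<tau>)) \<longlonglongrightarrow> 0"
    by (rule filterlim_compose[rotated])
  then have "(\<lambda>k. \<rho> ^ (k div \<tau>) * M) \<longlonglongrightarrow> 0"
    by (rule tendsto_mult_left_zero)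
  then have "(\<lambda>k. x k - xstar) \<longlonglongrightarrow> 0"
    by (rule Lim_null_comparison[rotated]) (simp add: bound)
  then have "x \<longlonglongrightarrow> xstar"
    by (simp add: LIM_zero_iff)
  with bound show ?thesis
    by (simp add: \<rho>_def M_def)
qed

end
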